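(* If $L$ is the Lemke graph, then $\pi(L)=8$.
   Context: The Lemke graph $L$ is the graph with the $8$ vertices $r,y,z,a,b,c,d,x$ and the $13$ edges $ry,\ rz,\ zd,\ ya,\ yb,\ yc,\ da,\ db,\ dc,\ dx,\ xa,\ xb,\ xc$. A configuration on a connected graph $G$ is a function $p:V(G)\to\mathbb{N}\cup\{0\}$; its size is $|p|=\sum_{v}p(v)$. A pebbling move removes two pebbles from some vertex and places one pebble on an adjacent vertex. For a root $r\in V(G)$, $p$ is solvable for $(G,r)$ if some (possibly empty) sequence of pebbling moves from $p$ yields a configuration with at least one pebble on $r$. The pebbling number $\pi(G)$ is the least integer $k$ such that for every vertex $v$, every configuration of size $k$ is solvable for $(G,v)$. *)

theory Defs
  imports "Graph_Theory.Digraph_Component"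
begin

section \<open>Pebbling\<close>

text \<open>
  As in the underlying graph library, a finite simple graph is a symmetric loop-free digraph
  (locale \<open>pair_graph\<close>): each undirected edge \<open>uv\<close> is present as the two arcs \<open>(u, v)\<close> and
  \<open>(v, u)\<close>.  A configuration on \<open>G\<close> is a function \<open>'a \<Rightarrow> nat\<close>; its values outside \<open>pverts G\<close> are
  irrelevant, since they are not counted in the size and, \<open>G\<close> being well-formed, no move
  touches them.
\<close>

definition conf_size :: "'a pair_pre_digraph \<Rightarrow> ('a \<Rightarrow> nat) \<Rightarrow> nat" where
  "conf_size G p = (\<Sum>v\<in>pverts G. p v)"

definition pebbling_move :: "'a pair_pre_digraph \<Rightarrow> ('a \<Rightarrow> nat) \<Rightarrow> ('a \<Rightarrow> nat) \<Rightarrow> bool" where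
  "pebbling_move G p q \<longleftrightarrow>
    (\<exists>u v. (u, v) \<in> parcs G \<and> 2 \<le> p u \<and> q = p(u := p u - 2, v := p v + 1))"

definition solvable :: "'a pair_pre_digraph \<Rightarrow> 'a \<Rightarrow> ('a \<Rightarrow> nat) \<Rightarrow> bool" where
  "solvable G r p \<longleftrightarrow> (\<exists>q. (pebbling_move G)\<^sup>*\<^sup>* p q \<and> 1 \<le> q r)"

definition pebbling_number :: "'a pair_pre_digraph \<Rightarrow> nat" where
  "pebbling_number G = (LEAST k. \<forall>v\<in>pverts G. \<forall>p. conf_size G p = k \<longrightarrow> solvable G v p)"


section \<open>The Lemke graph\<close>

datatype lemke_vertex = Vr | Vy | Vz | Va | Vb | Vc | Vd | Vx

definition lemke_edges :: "(lemke_vertex \<times> lemke_vertex) set" where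
  "lemke_edges =
    {(Vr, Vy), (Vr, Vz), (Vz, Vd), (Vy, Va), (Vy, Vb), (Vy, Vc),
     (Vd, Va), (Vd, Vb), (Vd, Vc), (Vd, Vx), (Vx, Va), (Vx, Vb), (Vx, Vc)}"

definition lemke_graph :: "lemke_vertex pair_pre_digraph" where
  "lemke_graph =
    \<lparr> pverts = {Vr, Vy, Vz, Va, Vb, Vc, Vd, Vx}, parcs = lemke_edges \<union> lemke_edges\<inverse> \<rparr>"

lemma pverts_lemke_graph: "pverts lemke_graph = UNIV"
  by (auto simp: lemke_graph_def intro: lemke_vertex.exhaust)

lemma card_pverts_lemke_graph: "card (pverts lemke_graph) = 8"
  by (simp add: lemke_graph_def)

lemma card_lemke_edges: "card lemke_edges = 13"
  by (simp add: lemke_edges_def)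

lemma pair_graph_lemke_graph: "pair_graph lemke_graph"
proof
  show "symmetric lemke_graph"
    by (auto simp: symmetric_def lemke_graph_def sym_def)
qed (auto simp: lemke_graph_def lemke_edges_def)

lemma connected_lemke_graph: "Digraph_Component.connected lemke_graph"
proof -
  interpret pair_graph lemke_graph by (rule pair_graph_lemke_graph)
  have sym: "v \<rightarrow>\<^sup>*\<^bsub>lemke_graph\<^esub> u" if "u \<rightarrow>\<^sup>*\<^bsub>lemke_graph\<^esub> v" for u v
    using that by (simp add: symmetric_reachable pair_sym_arcs)
  have step: "Vr \<rightarrow>\<^sup>*\<^bsub>lemke_graph\<^esub> v" if "Vr \<rightarrow>\<^sup>*\<^bsub>lemke_graph\<^esub> u" "(u, v) \<in> lemke_edges" for u v
  proof -
    from that(2) have "(u, v) \<in> parcs lemke_graph"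
      by (simp add: lemke_graph_def)
    with that(1) show ?thesis
      by (rule reachable_adj_trans)
  qed
  have r: "Vr \<rightarrow>\<^sup>*\<^bsub>lemke_graph\<^esub> Vr"
    by (rule reachable_refl) (simp add: pverts_lemke_graph)
  have y: "Vr \<rightarrow>\<^sup>*\<^bsub>lemke_graph\<^esub> Vy" and z: "Vr \<rightarrow>\<^sup>*\<^bsub>lemke_graph\<^esub> Vz"
    by (rule step[OF r], simp add: lemke_edges_def)+
  have d: "Vr \<rightarrow>\<^sup>*\<^bsub>lemke_graph\<^esub> Vd"
    by (rule step[OF z]) (simp add: lemke_edges_def)
  have abcx: "Vr \<rightarrow>\<^sup>*\<^bsub>lemke_graph\<^esub> Va" "Vr \<rightarrow>\<^sup>*\<^bsub>lemke_graph\<^esub> Vb"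
    "Vr \<rightarrow>\<^sup>*\<^bsub>lemke_graph\<^esub> Vc" "Vr \<rightarrow>\<^sup>*\<^bsub>lemke_graph\<^esub> Vx"
    by (rule step[OF d], simp add: lemke_edges_def)+
  have from_r: "Vr \<rightarrow>\<^sup>*\<^bsub>lemke_graph\<^esub> v" for v
    using r y z d abcx by (cases v) auto
  have "u \<rightarrow>\<^sup>*\<^bsub>lemke_graph\<^esub> v" for u v
    using reachable_trans[OF sym[OF from_r] from_r] .
  then show ?thesis
    by (auto simp: Digraph_Component.connected_def strongly_connected_def
        reachable_mk_symmetric_eq pair_sym_arcs pverts_lemke_graph)
qed

end

theory Submission
  imports Defs
begin

text \<open>
  Fewer than eight pebbles do not suffice: placed on distinct vertices other than the root, they
  admit no move.  In general this gives the order of a graph as a lower bound for its pebbling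
  number (\<open>unsolvable_below_order\<close>).

  The upper bound rests on Hurlbert's weight functions.  Let the root have weight \<open>0\<close>, and
  let each vertex of positive weight have a neighbour which is the root or carries at least twice
  its weight.  If the total weight of the pebbles exceeds the total weight of the vertices, some
  vertex of positive weight holds two pebbles, and moving them to that neighbour reaches the root
  or loses no weight.  As each move uses up a pebble, the root is reached eventually.  So every weight function yields a linear
  inequality for the unsolvable configurations (\<open>weight_function_lemma\<close>).  For each root but
  \<open>r\<close>, a positive combination of a few such inequalities says that an unsolvable
  configuration has size less than \<open>8\<close>; the chosen weights and multipliers are an optimal
  solution of a linear program.

  For the root \<open>r\<close> weight functions cannot suffice: the configuration with five pebbles on \<open>x\<close>
  and one on each of \<open>a\<close>, \<open>b\<close>, \<open>d\<close> satisfies all their inequalities.  It is solvable by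
  cooperation between branches: any two of \<open>a\<close>, \<open>b\<close>, \<open>c\<close> holding two pebbles each
  provide two pebbles on \<open>y\<close>, and single pebbles on \<open>a\<close>, \<open>b\<close>, \<open>c\<close> can be completed to pairs
  from \<open>d\<close> and \<open>x\<close> (\<open>two_pairs\<close>, \<open>pair_and_refill\<close>, \<open>two_refills\<close>).  The weight inequalities
  force at least two of \<open>a\<close>, \<open>b\<close>, \<open>c\<close> to be occupied in an unsolvable configuration of size
  \<open>8\<close>, and then the cooperation rules leave so few pebbles on the other vertices that every
  remaining distribution violates some weight inequality.
\<close>

section \<open>Moves and the lower bound\<close>

lemma solvable_if_pebble_on_root:
  assumes "1 \<le> p r"
  shows "solvable G r p"
  using assms unfolding solvable_def by blast

lemma solvable_move:
  assumes "(u, v) \<in> parcs G" "2 \<le> p u" "solvable G r (p(u := p u - 2, v := p v + 1))"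
  shows "solvable G r p"
proof -
  have "pebbling_move G p (p(u := p u - 2, v := p v + 1))"
    using assms(1,2) unfolding pebbling_move_def by blast
  then show ?thesis
    using assms(3) unfolding solvable_def by (meson converse_rtranclp_into_rtranclp)
qed

lemma solvable_neighbour:
  assumes "(u, r) \<in> parcs G" "2 \<le> p u"
  shows "solvable G r p"
  using assms by (rule solvable_move) (simp add: solvable_if_pebble_on_root)

lemma unsolvable_below_order:
  assumes "finite (pverts G)" "r \<in> pverts G" "k < card (pverts G)"
  shows "\<exists>p. conf_size G p = k \<and> \<not> solvable G r p"
proof -
  have "k \<le> card (pverts G - {r})"
    using assms by simp
  then obtain S where S: "S \<subseteq> pverts G - {r}" "card S = k"
    using assms(1) by (meson obtain_subset_with_card_n)
  define p where "p v = (if v \<in> S then 1 else 0 :: nat)" for v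
  have "conf_size G p = k"
    using S assms(1) by (auto simp: conf_size_def p_def sum.If_cases Int_absorb1 subset_Diff_insert)
  have "\<not> pebbling_move G p q" for q
    by (auto simp: pebbling_move_def p_def)
  then have "q = p" if "(pebbling_move G)\<^sup>*\<^sup>* p q" for q
    using that by (metis converse_rtranclpE)
  moreover have "p r = 0"
    using S(1) by (auto simp: p_def)
  ultimately have "\<not> solvable G r p"
    unfolding solvable_def by fastforce
  with \<open>conf_size G p = k\<close> show ?thesis
    by blast
qed

section \<open>Weight functions\<close>

definition weight_function :: "'a pair_pre_digraph \<Rightarrow> 'a \<Rightarrow> ('a \<Rightarrow> nat) \<Rightarrow> bool" where
  "weight_function G r w \<longleftrightarrow> w r = 0 \<and>
    (\<forall>v\<in>pverts G. 0 < w v \<longrightarrow> (\<exists>u. (v, u) \<in> parcs G \<and> (u = r \<or> 2 * w v \<le> w u)))"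

text \<open>
  This is the bookkeeping for one move; with constant weights \<open>1\<close> it says that a move uses up
  one pebble.
\<close>

lemma weighted_sum_move:
  fixes w p :: "'a \<Rightarrow> nat"
  assumes "finite V" "u \<in> V" "v \<in> V" "u \<noteq> v" "2 \<le> p u"
  shows "(\<Sum>t\<in>V. w t * (p(u := p u - 2, v := p v + 1)) t) + 2 * w u = (\<Sum>t\<in>V. w t * p t) + w v"
proof -
  define R where "R = V - {u, v}"
  have V: "V = insert u (insert v R)" and R: "finite R" "u \<notin> R" "v \<notin> R"
    using assms by (auto simp: R_def)
  have "(\<Sum>t\<in>R. w t * (p(u := p u - 2, v := p v + 1)) t) = (\<Sum>t\<in>R. w t * p t)"
    using R by (intro sum.cong) auto
  moreover obtain m where "p u = m + 2"
    using assms(5) by (metis add.commute le_Suc_ex)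
  ultimately show ?thesis
    using R assms(4) by (simp add: V algebra_simps)
qed

text \<open>
  The weight never drops along moves towards heavier neighbours, whereas the number of pebbles
  does; the induction is on the latter.
\<close>

lemma (in pair_digraph) weight_function_lemma:
  assumes w: "weight_function G r w" and "\<not> solvable G r p"
  shows "(\<Sum>v\<in>pverts G. w v * p v) \<le> (\<Sum>v\<in>pverts G. w v)"
  using assms(2)
proof (induction "conf_size G p" arbitrary: p rule: less_induct)
  case less
  show ?case
  proof (rule ccontr)
    assume heavy: "\<not> ?thesis"
    then obtain v where v: "v \<in> pverts G" "w v < w v * p v"
      by (meson not_le sum_mono)
    then have "0 < w v"
      by (cases "w v") simp_all
    from v(2) have two: "2 \<le> p v"
      by (cases "p v"; cases "p v - 1") simp_all
    obtain u where u: "(v, u) \<in> parcs G" "u = r \<or> 2 * w v \<le> w u"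
      using w v(1) \<open>0 < w v\<close> unfolding weight_function_def by blast
    define q where "q = p(v := p v - 2, u := p u + 1)"
    have "\<not> solvable G r q"
      using solvable_move[where r = r, OF u(1), of p] two less.prems unfolding q_def by blast
    moreover have "u \<noteq> r"
      using solvable_neighbour[of v r G p] u(1) two less.prems by blast
    moreover have uv: "u \<in> pverts G" "v \<noteq> u"
      using arc_snd_in_verts[OF u(1)] pair_no_loops[OF u(1)] by auto
    note move = weighted_sum_move[where p = p, OF pair_finite_verts v(1) uv(1,2) two, folded q_def]
    have "conf_size G q < conf_size G p"
      using move[of "\<lambda>_. 1"] by (simp add: conf_size_def)
    ultimately show False
      using less.hyps[of q] move[of w] u(2) heavy by auto
  qed
qed

section \<open>Weight functions on the Lemke graph\<close>

lemma ex_neighbour_lemke_graph: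
  "(\<exists>u. (Vr, u) \<in> parcs lemke_graph \<and> P u) \<longleftrightarrow> P Vy \<or> P Vz"
  "(\<exists>u. (Vy, u) \<in> parcs lemke_graph \<and> P u) \<longleftrightarrow> P Vr \<or> P Va \<or> P Vb \<or> P Vc"
  "(\<exists>u. (Vz, u) \<in> parcs lemke_graph \<and> P u) \<longleftrightarrow> P Vr \<or> P Vd"
  "(\<exists>u. (Va, u) \<in> parcs lemke_graph \<and> P u) \<longleftrightarrow> P Vy \<or> P Vd \<or> P Vx"
  "(\<exists>u. (Vb, u) \<in> parcs lemke_graph \<and> P u) \<longleftrightarrow> P Vy \<or> P Vd \<or> P Vx"
  "(\<exists>u. (Vc, u) \<in> parcs lemke_graph \<and> P u) \<longleftrightarrow> P Vy \<or> P Vd \<or> P Vx"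
  "(\<exists>u. (Vd, u) \<in> parcs lemke_graph \<and> P u) \<longleftrightarrow> P Vz \<or> P Va \<or> P Vb \<or> P Vc \<or> P Vx"
  "(\<exists>u. (Vx, u) \<in> parcs lemke_graph \<and> P u) \<longleftrightarrow> P Vd \<or> P Va \<or> P Vb \<or> P Vc"
  by (auto simp: lemke_graph_def lemke_edges_def)

lemma sum_lemke_graph:
  "(\<Sum>v\<in>pverts lemke_graph. f v) = f Vr + f Vy + f Vz + f Va + f Vb + f Vc + f Vd + f Vx"
  by (simp add: lemke_graph_def add.assoc)

definition lemke_weight ::
    "nat \<Rightarrow> nat \<Rightarrow> nat \<Rightarrow> nat \<Rightarrow> nat \<Rightarrow> nat \<Rightarrow> nat \<Rightarrow> nat \<Rightarrow> lemke_vertex \<Rightarrow> nat" where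
  "lemke_weight r y z a b c d x v = (case v of
     Vr \<Rightarrow> r | Vy \<Rightarrow> y | Vz \<Rightarrow> z | Va \<Rightarrow> a | Vb \<Rightarrow> b | Vc \<Rightarrow> c | Vd \<Rightarrow> d | Vx \<Rightarrow> x)"

lemma lemke_weight_simps [simp]:
  "lemke_weight r y z a b c d x Vr = r" "lemke_weight r y z a b c d x Vy = y"
  "lemke_weight r y z a b c d x Vz = z" "lemke_weight r y z a b c d x Va = a"
  "lemke_weight r y z a b c d x Vb = b" "lemke_weight r y z a b c d x Vc = c"
  "lemke_weight r y z a b c d x Vd = d" "lemke_weight r y z a b c d x Vx = x"
  by (simp_all add: lemke_weight_def)

lemma all_lemke_graph:
  "(\<forall>v\<in>pverts lemke_graph. P v) \<longleftrightarrow> P Vr \<and> P Vy \<and> P Vz \<and> P Va \<and> P Vb \<and> P Vc \<and> P Vd \<and> P Vx"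
  by (simp add: lemke_graph_def)

lemmas lemke_weight_function_simps =
  weight_function_def all_lemke_graph ex_neighbour_lemke_graph

lemma lemke_weight_bound:
  assumes "\<not> solvable lemke_graph s p"
    and "weight_function lemke_graph s (lemke_weight r y z a b c d x)"
  shows "r * p Vr + y * p Vy + z * p Vz + a * p Va + b * p Vb + c * p Vc + d * p Vd + x * p Vx
    \<le> r + y + z + a + b + c + d + x"
  using pair_digraph.weight_function_lemma[OF pair_graph.axioms(1) assms(2,1)]
    pair_graph_lemke_graph
  by (simp add: sum_lemke_graph)

lemma conf_size_lemke_graph:
  "conf_size lemke_graph p = p Vr + p Vy + p Vz + p Va + p Vb + p Vc + p Vd + p Vx"
  by (simp add: conf_size_def sum_lemke_graph)

section \<open>Roots other than r\<close>

lemma unsolvable_size_y: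
  assumes "\<not> solvable lemke_graph Vy p"
  shows "conf_size lemke_graph p < 8"
proof -
  note bound = lemke_weight_bound[OF assms]
  have "p Vy = 0"
    using assms solvable_if_pebble_on_root[of p Vy] by (metis One_nat_def Suc_leI neq0_conv)
  moreover have "2 * p Vr + p Vz \<le> 3"
    using bound[of 2 0 1 0 0 0 0 0] by (simp add: lemke_weight_function_simps)
  moreover have "2 * p Va + p Vx \<le> 3"
    using bound[of 0 0 0 2 0 0 0 1] by (simp add: lemke_weight_function_simps)
  moreover have "p Vz + 4 * p Vb + 2 * p Vd \<le> 7"
    using bound[of 0 0 1 0 4 0 2 0] by (simp add: lemke_weight_function_simps)
  moreover have "p Vz + 4 * p Vc + 2 * p Vd + 2 * p Vx \<le> 9"
    using bound[of 0 0 1 0 0 4 2 2] by (simp add: lemke_weight_function_simps)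
  \<comment> \<open>With multipliers 2, 2, 1, 1 these inequalities give \<open>4 |p| \<le> 28\<close>.\<close>
  ultimately show ?thesis
    unfolding conf_size_lemke_graph by linarith
qed

lemma unsolvable_size_z:
  assumes "\<not> solvable lemke_graph Vz p"
  shows "conf_size lemke_graph p < 8"
proof -
  note bound = lemke_weight_bound[OF assms]
  have "p Vz = 0"
    using assms solvable_if_pebble_on_root[of p Vz] by (metis One_nat_def Suc_leI neq0_conv)
  moreover have "p Vy + p Va + 2 * p Vb + 2 * p Vc + 4 * p Vd + 2 * p Vx \<le> 12"
    using bound[of 0 1 0 1 2 2 4 2] by (simp add: lemke_weight_function_simps)
  moreover have "p Vy + 2 * p Va + 2 * p Vb + 2 * p Vc + 4 * p Vd + 2 * p Vx \<le> 13"
    using bound[of 0 1 0 2 2 2 4 2] by (simp add: lemke_weight_function_simps)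
  moreover have "8 * p Vr + 4 * p Vy + 2 * p Va + 2 * p Vb + p Vx \<le> 17"
    using bound[of 8 4 0 2 2 0 0 1] by (simp add: lemke_weight_function_simps)
  moreover have "8 * p Vr + 4 * p Vy + 2 * p Va + 2 * p Vc + p Vx \<le> 17"
    using bound[of 8 4 0 2 0 2 0 1] by (simp add: lemke_weight_function_simps)
  \<comment> \<open>With multipliers 2, 4, 1, 1 these inequalities give \<open>14 |p| \<le> 110\<close>.\<close>
  ultimately show ?thesis
    unfolding conf_size_lemke_graph by linarith
qed

text \<open>
  The conditions on a weight function treat \<open>a\<close>, \<open>b\<close> and \<open>c\<close> alike, so the same weights serve
  for these three roots.
\<close>

lemma unsolvable_size_abc:
  assumes "\<not> solvable lemke_graph u p"
    and uvw: "(u, v, w) \<in> {(Va, Vb, Vc), (Vb, Va, Vc), (Vc, Va, Vb)}"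
  shows "conf_size lemke_graph p < 8"
proof -
  note bound = lemke_weight_bound[OF assms(1)]
  have "p u = 0"
    using assms solvable_if_pebble_on_root[of p u] by (metis One_nat_def Suc_leI neq0_conv)
  moreover have "p Vx \<le> 1"
    using bound[of 0 0 0 0 0 0 0 1] uvw by (auto simp: lemke_weight_function_simps)
  moreover have "p Vr + 2 * p Vz + 2 * p v + 2 * p w + 4 * p Vd \<le> 11"
    using bound[of 1 0 2 0 2 2 4 0] bound[of 1 0 2 2 0 2 4 0] bound[of 1 0 2 2 2 0 4 0] uvw
    by (auto simp: lemke_weight_function_simps)
  moreover have "2 * p Vr + 4 * p Vy + p Vz + 2 * p v \<le> 9"
    using bound[of 2 4 1 2 0 0 0 0] bound[of 2 4 1 0 2 0 0 0] uvw
    by (auto simp: lemke_weight_function_simps)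
  moreover have "2 * p Vr + 4 * p Vy + p Vz + 2 * p w \<le> 9"
    using bound[of 2 4 1 0 2 0 0 0] bound[of 2 4 1 0 0 2 0 0] uvw
    by (auto simp: lemke_weight_function_simps)
  moreover have "conf_size lemke_graph p = p Vr + p Vy + p Vz + p u + p v + p w + p Vd + p Vx"
    using uvw by (auto simp: conf_size_lemke_graph)
  \<comment> \<open>With multipliers 6, 2, 1, 1 the four inequalities give \<open>6 |p| \<le> 46\<close>.\<close>
  ultimately show ?thesis
    by linarith
qed

lemma unsolvable_size_d:
  assumes "\<not> solvable lemke_graph Vd p"
  shows "conf_size lemke_graph p < 8"
proof -
  note bound = lemke_weight_bound[OF assms]
  have "p Vd = 0"
    using assms solvable_if_pebble_on_root[of p Vd] by (metis One_nat_def Suc_leI neq0_conv)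
  moreover have "p Vx \<le> 1"
    using bound[of 0 0 0 0 0 0 0 1] by (simp add: lemke_weight_function_simps)
  moreover have "p Vc \<le> 1"
    using bound[of 0 0 0 0 0 1 0 0] by (simp add: lemke_weight_function_simps)
  moreover have "p Vr + 2 * p Vz \<le> 3"
    using bound[of 1 0 2 0 0 0 0 0] by (simp add: lemke_weight_function_simps)
  moreover have "p Vr + 2 * p Vy + 4 * p Va \<le> 7"
    using bound[of 1 2 0 4 0 0 0 0] by (simp add: lemke_weight_function_simps)
  moreover have "p Vr + 2 * p Vy + 4 * p Vb \<le> 7"
    using bound[of 1 2 0 0 4 0 0 0] by (simp add: lemke_weight_function_simps)
  \<comment> \<open>With multipliers 4, 4, 2, 1, 1 these inequalities give \<open>4 |p| \<le> 28\<close>.\<close>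
  ultimately show ?thesis
    unfolding conf_size_lemke_graph by linarith
qed

lemma unsolvable_size_x:
  assumes "\<not> solvable lemke_graph Vx p"
  shows "conf_size lemke_graph p < 8"
proof -
  note bound = lemke_weight_bound[OF assms]
  have "p Vx = 0"
    using assms solvable_if_pebble_on_root[of p Vx] by (metis One_nat_def Suc_leI neq0_conv)
  moreover have "p Vc \<le> 1"
    using bound[of 0 0 0 0 0 1 0 0] by (simp add: lemke_weight_function_simps)
  moreover have "p Vr + 2 * p Vz + 4 * p Vd \<le> 7"
    using bound[of 1 0 2 0 0 0 4 0] by (simp add: lemke_weight_function_simps)
  moreover have "2 * p Vr + 4 * p Vy + p Vz + 8 * p Va \<le> 15"
    using bound[of 2 4 1 8 0 0 0 0] by (simp add: lemke_weight_function_simps)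
  moreover have "2 * p Vr + 4 * p Vy + p Vz + 8 * p Vb \<le> 15"
    using bound[of 2 4 1 0 8 0 0 0] by (simp add: lemke_weight_function_simps)
  moreover have "2 * p Vr + 4 * p Vy + p Vz + 8 * p Vc \<le> 15"
    using bound[of 2 4 1 0 0 8 0 0] by (simp add: lemke_weight_function_simps)
  \<comment> \<open>With multipliers 8, 8, 3, 3, 2 these inequalities give \<open>24 |p| \<le> 184\<close>.\<close>
  ultimately show ?thesis
    unfolding conf_size_lemke_graph by linarith
qed

section \<open>The root r\<close>

text \<open>
  The two pairs put two pebbles on \<open>y\<close>, one from each side, and these put one on \<open>r\<close>.  No
  weight function sees this: with weights \<open>2\<close> on \<open>u\<close> and \<open>v\<close> and \<open>4\<close> on \<open>y\<close>, the four pebbles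
  weigh exactly as much as the vertices.
\<close>

lemma two_pairs:
  assumes "u \<in> {Va, Vb, Vc}" "v \<in> {Va, Vb, Vc}" "u \<noteq> v" "2 \<le> p u" "2 \<le> p v"
  shows "solvable lemke_graph Vr p"
proof -
  have arcs: "(u, Vy) \<in> parcs lemke_graph" "(v, Vy) \<in> parcs lemke_graph"
      "(Vy, Vr) \<in> parcs lemke_graph" and "u \<noteq> Vy" "v \<noteq> Vy"
    using assms(1,2) by (auto simp: lemke_graph_def lemke_edges_def)
  show ?thesis
    by (rule solvable_move[OF arcs(1)], rule assms, rule solvable_move[OF arcs(2)])
      (use assms \<open>u \<noteq> Vy\<close> \<open>v \<noteq> Vy\<close> in \<open>auto intro!: solvable_neighbour[OF arcs(3)]\<close>)
qed

lemma pair_and_refill: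
  assumes "u \<in> {Va, Vb, Vc}" "v \<in> {Va, Vb, Vc}" "u \<noteq> v" "s \<in> {Vd, Vx}"
    and "2 \<le> p u" "1 \<le> p v" "2 \<le> p s"
  shows "solvable lemke_graph Vr p"
proof (rule solvable_move[of s v])
  show "(s, v) \<in> parcs lemke_graph"
    using assms by (auto simp: lemke_graph_def lemke_edges_def)
  show "solvable lemke_graph Vr (p(s := p s - 2, v := p v + 1))"
    using assms by (intro two_pairs[of u v]) auto
qed (fact assms)

lemma two_refills:
  assumes "u \<in> {Va, Vb, Vc}" "v \<in> {Va, Vb, Vc}" "u \<noteq> v"
    and "1 \<le> p u" "1 \<le> p v" and "4 \<le> p Vx \<or> (2 \<le> p Vx \<and> 2 \<le> p Vd)"
  shows "solvable lemke_graph Vr p"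
proof (rule solvable_move[of Vx u])
  show "(Vx, u) \<in> parcs lemke_graph"
    using assms by (auto simp: lemke_graph_def lemke_edges_def)
  show "2 \<le> p Vx"
    using assms by auto
  let ?q = "p(Vx := p Vx - 2, u := p u + 1)"
  have "2 \<le> ?q Vx \<or> 2 \<le> ?q Vd"
    using assms by auto
  then obtain s where "s \<in> {Vd, Vx}" "2 \<le> ?q s"
    by blast
  then show "solvable lemke_graph Vr ?q"
    using assms by (intro pair_and_refill[of u v s]) auto
qed

text \<open>
  By symmetry the vertices \<open>a\<close>, \<open>b\<close>, \<open>c\<close> may be named \<open>u\<close>, \<open>v\<close>, \<open>w\<close> in the order of their
  pebbles.  Adding the inequalities of the paths \<open>z d x\<close> and \<open>y u x\<close> shows that \<open>v\<close> and \<open>w\<close>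
  together hold more pebbles than \<open>y\<close> and \<open>z\<close>; in particular \<open>u\<close> and \<open>v\<close> are occupied, which
  is the situation of the cooperation rules.
\<close>

lemma unsolvable_size_r:
  assumes unsolv: "\<not> solvable lemke_graph Vr p"
  shows "conf_size lemke_graph p \<noteq> 8"
proof
  assume size: "conf_size lemke_graph p = 8"
  note bound = lemke_weight_bound[OF unsolv]
  have "p Vr = 0"
    using unsolv solvable_if_pebble_on_root[of p Vr] by (metis One_nat_def Suc_leI neq0_conv)
  have zdx: "4 * p Vz + 2 * p Vd + p Vx \<le> 7"
    using bound[of 0 0 4 0 0 0 2 1] by (simp add: lemke_weight_function_simps)
  have z_tree: "4 * p Vz + 2 * p Vd + p Va + p Vb + p Vc + p Vx \<le> 10"
    using bound[of 0 0 4 1 1 1 2 1] by (simp add: lemke_weight_function_simps)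
  have y_path: "4 * p Vy + 2 * p t + p Vx \<le> 7" "4 * p Vy + 2 * p t + p Vd \<le> 7"
    if "t \<in> {Va, Vb, Vc}" for t
    using that bound[of 0 4 0 2 0 0 0 1] bound[of 0 4 0 0 2 0 0 1] bound[of 0 4 0 0 0 2 0 1]
      bound[of 0 4 0 2 0 0 1 0] bound[of 0 4 0 0 2 0 1 0] bound[of 0 4 0 0 0 2 1 0]
    by (auto simp: lemke_weight_function_simps)
  obtain u v w where sorted: "p w \<le> p v" "p v \<le> p u"
    and uvw: "(u, v, w) \<in> {(Va, Vb, Vc), (Va, Vc, Vb), (Vb, Va, Vc), (Vb, Vc, Va),
      (Vc, Va, Vb), (Vc, Vb, Va)}"
    using linorder_linear[of "p Va" "p Vb"] linorder_linear[of "p Va" "p Vc"]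
      linorder_linear[of "p Vb" "p Vc"] by blast
  then have mem: "u \<in> {Va, Vb, Vc}" "v \<in> {Va, Vb, Vc}" and "u \<noteq> v"
    and sum_uvw: "p u + p v + p w = p Va + p Vb + p Vc"
    by auto
  have eight: "p Vy + p Vz + p u + p v + p w + p Vd + p Vx = 8"
    using size \<open>p Vr = 0\<close> sum_uvw by (simp add: conf_size_lemke_graph)
  have "p Vy + p Vz + 1 \<le> p v + p w"
    using zdx y_path(1)[OF mem(1)] eight by linarith
  moreover have "p v \<le> 1"
    using two_pairs[of u v p] unsolv mem \<open>u \<noteq> v\<close> sorted by linarith
  ultimately have v: "p v = 1" and w: "p w \<le> 1" and yz: "p Vy + p Vz \<le> 1"
    using sorted by linarith+
  show False
  proof (cases "p u \<le> 1")
    case True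
    then have u: "p u = 1"
      using v sorted by linarith
    then have "p Vx < 4" "p Vx < 2 \<or> p Vd < 2"
      using two_refills[of u v p] unsolv mem \<open>u \<noteq> v\<close> v by fastforce+
    then have "p Vx + p Vd \<le> 4"
      using zdx by linarith
    then have xd: "p Vx + p Vd = 4" and "p Vy + p Vz = 1"
      using eight u v w yz by linarith+
    then consider "p Vy = 1" | "p Vz = 1"
      by linarith
    then show False
    proof cases
      case 1
      then show False
        using y_path[OF mem(1)] u xd by linarith
    next
      case 2
      then show False
        using zdx \<open>p Vx < 4\<close> xd by linarith
    qed
  next
    case False
    then have dx: "p Vd \<le> 1" "p Vx \<le> 1"
      using pair_and_refill[of u v Vd p] pair_and_refill[of u v Vx p]
        unsolv mem \<open>u \<noteq> v\<close> v by fastforce+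
    have "p Vy = 0"
      using y_path[OF mem(1)] False by linarith
    then have "p u \<le> 3"
      using y_path(1)[OF mem(1)] by linarith
    \<comment> \<open>Now only three pebbles on \<open>u\<close> and one on each of \<open>v\<close>, \<open>w\<close>, \<open>z\<close>, \<open>d\<close>, \<open>x\<close> add up to
      eight, and they weigh \<open>12 > 10\<close> on the tree below \<open>z\<close>.\<close>
    then show False
      using z_tree sum_uvw eight v w yz dx \<open>p Vy = 0\<close> by linarith
  qed
qed

section \<open>The pebbling number\<close>

theorem theorem2:
  shows "pebbling_number lemke_graph = 8"
  unfolding pebbling_number_def
proof (rule Least_equality)
  show "\<forall>v\<in>pverts lemke_graph. \<forall>p. conf_size lemke_graph p = 8 \<longrightarrow> solvable lemke_graph v p"
  proof (intro ballI allI impI, rule ccontr)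
    fix v p
    assume "conf_size lemke_graph p = 8" "\<not> solvable lemke_graph v p"
    then show False
      using unsolvable_size_r[of p] unsolvable_size_y[of p] unsolvable_size_z[of p]
        unsolvable_size_abc[of Va p Vb Vc] unsolvable_size_abc[of Vb p Va Vc]
        unsolvable_size_abc[of Vc p Va Vb] unsolvable_size_d[of p] unsolvable_size_x[of p]
      by (cases v) auto
  qed
next
  fix k
  assume solv: "\<forall>v\<in>pverts lemke_graph. \<forall>p. conf_size lemke_graph p = k \<longrightarrow> solvable lemke_graph v p"
  show "8 \<le> k"
  proof (rule ccontr)
    assume "\<not> 8 \<le> k"
    then have "k < card (pverts lemke_graph)"
      by (simp add: card_pverts_lemke_graph)
    then show False
      using unsolvable_below_order[of lemke_graph Vr k] solv by (auto simp: lemke_graph_def)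
  qed
qed

end
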